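(* Let $A_0,B_0\in\mathbb{R}^{n\times n}$ be permutable matrices, $A_0B_0=B_0A_0$, let $1<\alpha\le2$, $0<\beta\le1$, $\eta,\hat\eta\in\mathbb{R}^n$, and let $g:\mathbb{J}\to\mathbb{R}^n$ be continuous. The exact analytical solution $y(\cdot)\in\mathbb{C}^2(\mathbb{J},\mathbb{R}^n)$ of the Cauchy problem $$\left({}^{C}D^{\alpha}_{0+}y\right)(t)-A_0\left({}^{C}D^{\beta}_{0+}y\right)(t)-B_0y(t)=g(t),\quad t>0,\qquad y(0)=\eta,\quad y'(0)=\hat\eta,$$ can be represented, for $t>0$, by $$\begin{aligned}y(t)&=\Big(I+\sum_{k=0}^{\infty}\sum_{m=0}^{\infty}\binom{k+m}{m}A_0^kB_0^{m+1}\frac{t^{k(\alpha-\beta)+m\alpha+\alpha}}{\Gamma(k(\alpha-\beta)+m\alpha+\alpha+1)}\Big)\eta\\&\quad+\sum_{k=0}^{\infty}\sum_{m=0}^{\infty}\binom{k+m}{m}A_0^kB_0^m\frac{t^{k(\alpha-\beta)+m\alpha+1}}{\Gamma(k(\alpha-\beta)+m\alpha+2)}\hat\eta\\&\quad+\int_0^t\sum_{k=0}^{\infty}\sum_{m=0}^{\infty}\binom{k+m}{m}A_0^kB_0^m\frac{(t-s)^{k(\alpha-\beta)+m\alpha+\alpha-1}}{\Gamma(k(\alpha-\beta)+m\alpha+\alpha)}g(s)\,ds.\end{aligned}$$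
   Context: $\mathbb{J}=[0,T]$; $\mathbb{C}^2(\mathbb{J},\mathbb{R}^n)$ is the space of twice continuously differentiable functions $\mathbb{J}\to\mathbb{R}^n$; $I$ is the identity matrix. For $N-1<\nu\le N$, $N\in\mathbb{N}$, the Caputo derivative is $({}^{C}D^{\nu}_{0+}y)(t)=\frac{1}{\Gamma(N-\nu)}\int_0^t(t-s)^{N-\nu-1}y^{(N)}(s)\,ds$, understood as $y^{(N)}(t)$ when $\nu=N$. *)

theory Defs
  imports "HOL-Analysis.Analysis"
begin

(* The product "*", hence also "^", on the type real^'n^'n is componentwise;
   powers with respect to the matrix product need their own definition. *)
primrec matpow :: "real^'n^'n \<Rightarrow> nat \<Rightarrow> real^'n^'n" where
  "matpow A 0 = mat 1"
| "matpow A (Suc k) = A ** matpow A k"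

(* The derivative of order k of a function on J, taken relative to J, i.e. one-sided
   at the end points of an interval. *)
definition deriv_on :: "real set \<Rightarrow> nat \<Rightarrow> (real \<Rightarrow> 'a::real_normed_vector) \<Rightarrow> real \<Rightarrow> 'a" where
  "deriv_on J k y = ((\<lambda>f t. vector_derivative f (at t within J)) ^^ k) y"

definition C_k_on :: "nat \<Rightarrow> real set \<Rightarrow> (real \<Rightarrow> 'a::real_normed_vector) \<Rightarrow> bool" where
  "C_k_on k J y \<longleftrightarrow>
     (\<forall>i<k. \<forall>t\<in>J. deriv_on J i y differentiable (at t within J)) \<and>
     continuous_on J (deriv_on J k y)"

(* Caputo derivative of order \<nu> > 0 of a function on J = {0..T}; the N with
   N - 1 < \<nu> \<le> N is the ceiling of \<nu>. *)
definition caputo ::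
  "real set \<Rightarrow> real \<Rightarrow> (real \<Rightarrow> 'a::euclidean_space) \<Rightarrow> real \<Rightarrow> 'a" where
  "caputo J \<nu> y t =
     (let N = nat \<lceil>\<nu>\<rceil> in
      if \<nu> = real N then deriv_on J N y t
      else (1 / Gamma (real N - \<nu>)) *\<^sub>R
             integral {0..t} (\<lambda>s. (t - s) powr (real N - \<nu> - 1) *\<^sub>R deriv_on J N y s))"

(* Convergence of the iterated series (\<Sum>k. \<Sum>m. f k m); suminf itself carries no
   information about convergence. *)
definition double_summable :: "(nat \<Rightarrow> nat \<Rightarrow> 'a::real_normed_vector) \<Rightarrow> bool" where
  "double_summable f \<longleftrightarrow> (\<forall>k. summable (f k)) \<and> summable (\<lambda>k. \<Sum>m. f k m)"

end

theory Submission
  imports Defs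
begin

text \<open>
  Write \<open>I^c\<close> for the Riemann-Liouville integral of order \<open>c\<close>, put \<open>a = \<alpha> - \<beta>\<close> and subtract the
  initial value, \<open>z = y - \<eta>\<close>; the shift leaves both Caputo derivatives unchanged.  Applying
  \<open>I^\<alpha>\<close> to the differential equation and using the semigroup law \<open>I^c I^d = I^(c+d)\<close> together
  with \<open>I^1 y' = z\<close> turns the Cauchy problem into the Volterra equation
  \<open>z = h + A0 I^a z + B0 I^\<alpha> z\<close> with \<open>h = I^1 \<eta>' + I^\<alpha> (g + B0 \<eta>)\<close>
  (\<open>cauchy_problem_volterra\<close>).  Working with \<open>z\<close> instead of \<open>y\<close> is what produces the
  coefficient of \<open>\<eta>\<close> directly in the form \<open>I + (\<Sum> ... A0^k B0^(m+1) ...)\<close>.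

  Since \<open>A0\<close> and \<open>B0\<close> commute, substituting the Volterra equation into itself \<open>N\<close> times gives, by
  Pascal's rule, the sum of \<open>binom(k+m, m) A0^k B0^m I^(ka+m\<alpha>) h\<close> over \<open>k + m < N\<close>, plus a
  remainder of the same shape with \<open>z\<close> in place of \<open>h\<close> and \<open>k + m = N\<close> (\<open>volterra_series\<close>).
  Convergence rests on one estimate: \<open>t^x / Gamma(x+1) \<le> e^(R+1) (t/R)^x\<close> for every \<open>R > 0\<close>.
  For large \<open>R\<close> it beats the growth of the matrix powers and of the binomial coefficients,
  and the \<open>(k, m)\<close> term is at most \<open>C / 2^(k+m)\<close>, uniformly in time
  (\<open>mittag_leffler_term_bound\<close>).  Hence the remainder vanishes, the triangular partial sums
  converge to the iterated series, and dominated convergence moves the double series inside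
  the integral against \<open>g\<close> (\<open>mittag_leffler_term_convolution\<close>).

  The semigroup law is obtained without a change of the order of integration: on monomials it
  is the Beta integral, and both sides are continuous in the uniform norm, so Weierstrass
  approximation gives it for all continuous functions (\<open>RL_semigroup\<close>).
\<close>

section \<open>Double series with geometric majorant\<close>

text \<open>The majorant is summable over all pairs of indices, so the family converges
  unconditionally; the iterated series and the triangular partial sums are then two ways of
  exhausting the same sum.\<close>
lemma geometric_double_series:
  fixes f :: "nat \<Rightarrow> nat \<Rightarrow> 'a::banach"
  assumes le: "\<And>k m. norm (f k m) \<le> C * (1/2)^k * (1/2)^m"
  shows geometric_double_series_summable: "double_summable f"
    and geometric_double_series_triangle:
      "(\<lambda>n. \<Sum>k\<le>n. f k (n - k)) sums (\<Sum>k. \<Sum>m. f k m)"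
    and geometric_double_series_bound:
      "norm (\<Sum>n<N. \<Sum>k\<le>n. f k (n - k)) \<le> 4 * C"
proof -
  have C: "0 \<le> C"
    using order_trans[OF norm_ge_zero le[of 0 0]] by simp
  have geo: "summable (\<lambda>m. C * (1/2)^k * (1/2::real)^m)" for k
    by (intro summable_mult summable_geometric) auto
  have geo_sum: "(\<Sum>m. C * (1/2)^k * (1/2::real)^m) = 2 * C * (1/2)^k" for k
    using suminf_geometric[of "1/2::real"] by (subst suminf_mult) (auto intro: summable_geometric)
  have row: "summable (\<lambda>m. norm (f k m))" for k
    by (rule summable_comparison_test'[OF geo[of k], of 0]) (use le in auto)
  have row_le: "(\<Sum>m. norm (f k m)) \<le> 2 * C * (1/2)^k" for k
    using suminf_le[OF le row geo] geo_sum by simp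
  have geo2: "summable (\<lambda>k. 2 * C * (1/2::real)^k)"
    by (intro summable_mult summable_geometric) auto
  have col: "summable (\<lambda>k. \<Sum>m. norm (f k m))"
    by (rule summable_comparison_test'[OF geo2, of 0]) (use row_le row in \<open>simp add: suminf_nonneg\<close>)
  have col': "summable (\<lambda>k. norm (\<Sum>m. f k m))"
    by (rule summable_comparison_test'[OF col, of 0]) (use row summable_norm in auto)
  show "double_summable f"
    unfolding double_summable_def by (auto intro: summable_norm_cancel[OF row] summable_norm_cancel[OF col'])
  have inf_row: "infsum (h k) UNIV = suminf (h k)" if "\<And>k. summable (\<lambda>m. norm (h k m))" 
    for h :: "nat \<Rightarrow> nat \<Rightarrow> 'b::banach" and k
    using norm_summable_imp_has_sum[OF that summable_sums[OF summable_norm_cancel[OF that]]] infsumI by blast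
  have "(\<lambda>(k, m). f k m) abs_summable_on (UNIV \<times> UNIV)"
    by (rule summable_on_SigmaI[where g = "\<lambda>k. \<Sum>m. norm (f k m)"])
       (use row col in \<open>auto intro!: norm_summable_imp_has_sum summable_sums
          summable_nonneg_imp_summable_on suminf_nonneg\<close>)
  then have summ: "(\<lambda>(k, m). f k m) summable_on (UNIV \<times> UNIV)"
    by (rule abs_summable_summable)
  have "infsum (\<lambda>(k, m). f k m) (UNIV \<times> UNIV) = infsum (\<lambda>k. suminf (f k)) UNIV"
    using infsum_Sigma_banach[OF summ] inf_row[of f, OF row] by simp
  also have "\<dots> = (\<Sum>k. \<Sum>m. f k m)"
    using norm_summable_imp_has_sum[OF col' summable_sums[OF summable_norm_cancel[OF col']]] infsumI by blast
  finally have "((\<lambda>(k, m). f k m) has_sum (\<Sum>k. \<Sum>m. f k m)) (UNIV \<times> UNIV)"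
    using summ by (metis has_sum_infsum)
  \<comment> \<open>Every finite set of index pairs lies in a large triangle.\<close>
  moreover have "filterlim (\<lambda>N. {(k, m). k + m < N}) (finite_subsets_at_top (UNIV \<times> UNIV)) sequentially"
    unfolding filterlim_finite_subsets_at_top
  proof (intro allI impI)
    fix X :: "(nat \<times> nat) set"
    assume X: "finite X \<and> X \<subseteq> UNIV \<times> UNIV"
    have fin: "finite {(k, m). k + m < N}" for N :: nat
      by (rule finite_subset[of _ "{..<N} \<times> {..<N}"]) auto
    obtain M where M: "\<And>x. x \<in> X \<Longrightarrow> fst x + snd x < M"
      using X finite_nat_set_iff_bounded[of "(\<lambda>x. fst x + snd x) ` X"] by auto
    show "\<forall>\<^sub>F N in sequentially. finite {(k, m). k + m < N} \<and> X \<subseteq> {(k, m). k + m < N}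
        \<and> {(k, m). k + m < N} \<subseteq> UNIV \<times> UNIV"
      using eventually_ge_at_top[of M] by eventually_elim (use fin M in fastforce)
  qed
  ultimately have "(\<lambda>N. \<Sum>(k, m)\<in>{(k, m). k + m < N}. f k m) \<longlonglongrightarrow> (\<Sum>k. \<Sum>m. f k m)"
    unfolding has_sum_def by (rule filterlim_compose)
  then show "(\<lambda>n. \<Sum>k\<le>n. f k (n - k)) sums (\<Sum>k. \<Sum>m. f k m)"
    unfolding sums_def by (simp add: sum.triangle_reindex)
  have half: "(\<Sum>k<N. (1/2::real)^k) \<le> 2"
    by (subst sum_gp_strict) auto
  have "norm (\<Sum>n<N. \<Sum>k\<le>n. f k (n - k)) = norm (\<Sum>(k, m)\<in>{(k, m). k + m < N}. f k m)"
    by (simp add: sum.triangle_reindex)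
  also have "\<dots> \<le> (\<Sum>(k, m)\<in>{(k, m). k + m < N}. C * (1/2)^k * (1/2)^m)"
    by (rule sum_norm_le) (use le in auto)
  also have "\<dots> \<le> (\<Sum>(k, m)\<in>{..<N} \<times> {..<N}. C * (1/2)^k * (1/2)^m)"
    by (rule sum_mono2) (use C in auto)
  also have "\<dots> = C * ((\<Sum>k<N. (1/2)^k) * (\<Sum>m<N. (1/2)^m))"
    by (simp only: sum.cartesian_product[symmetric] sum_product)
       (simp add: sum_distrib_left mult.assoc)
  also have "\<dots> \<le> C * (2 * 2)"
    by (intro mult_left_mono mult_mono half C) (auto intro: sum_nonneg)
  finally show "norm (\<Sum>n<N. \<Sum>k\<le>n. f k (n - k)) \<le> 4 * C" by simp
qed

section \<open>Fractional monomials\<close>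

text \<open>At positive times this is the Riemann-Liouville integral of order \<open>c\<close> of the constant \<open>1\<close>.\<close>
definition frac_power :: "real \<Rightarrow> real \<Rightarrow> real" where
  "frac_power c t = t powr c / Gamma (c + 1)"

lemma frac_power_nonneg: "0 \<le> c \<Longrightarrow> 0 \<le> frac_power c t"
  unfolding frac_power_def by (simp add: Gamma_real_nonneg)

text \<open>Already the part of the Gamma integral over \<open>{R..R + 1}\<close> is at least
  \<open>R powr c / exp (R + 1)\<close>.  As \<open>R\<close> is arbitrary, \<open>frac_power c t\<close> decays in \<open>c\<close> faster
  than any geometric sequence, without appeal to Stirling's formula.\<close>
lemma frac_power_le:
  assumes "0 \<le> c" "0 < R" "0 \<le> t"
  shows "frac_power c t \<le> exp (R + 1) * (t / R) powr c"
proof -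
  have G: "((\<lambda>s. s powr c / exp s) has_integral Gamma (c + 1)) {0..}"
    using Gamma_integral_real[of "c + 1"] assms by simp
  have "((\<lambda>s. R powr c / exp (R + 1)) has_integral (R powr c / exp (R + 1))) {R..R + 1}"
    using has_integral_const_real[of "R powr c / exp (R + 1)" R "R + 1"] by simp
  moreover have "(\<lambda>s. s powr c / exp s) integrable_on {R..R+1}"
    by (rule integrable_continuous_real) (use assms in \<open>auto intro!: continuous_intros\<close>)
  ultimately have "R powr c / exp (R + 1) \<le> integral {R..R+1} (\<lambda>s. s powr c / exp s)"
    by (rule has_integral_le[OF _ integrable_integral])
       (use assms in \<open>auto intro!: frac_le powr_mono2\<close>)
  also have "\<dots> \<le> integral {0..} (\<lambda>s. s powr c / exp s)"
    by (rule integral_subset_le) (use assms G \<open>_ integrable_on {R..R+1}\<close> in auto)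
  also have "\<dots> = Gamma (c + 1)"
    using G by (rule integral_unique)
  finally have *: "R powr c / exp (R + 1) \<le> Gamma (c + 1)" .
  have "frac_power c t \<le> t powr c / (R powr c / exp (R + 1))"
    unfolding frac_power_def by (rule divide_left_mono[OF *]) (use assms in \<open>auto intro!: mult_pos_pos Gamma_real_pos\<close>)
  also have "\<dots> = exp (R + 1) * (t / R) powr c"
    using assms by (simp add: powr_divide)
  finally show ?thesis .
qed

section \<open>The Riemann-Liouville integral\<close>

text \<open>Order \<open>0\<close> is defined separately as the identity, since the kernel \<open>(t - s) powr (- 1)\<close> is not
  integrable.  With this convention the semigroup law holds for all nonnegative orders, and it
  agrees with the special case of integer order in the Caputo derivative.\<close>
definition RL :: "real \<Rightarrow> (real \<Rightarrow> 'a::euclidean_space) \<Rightarrow> real \<Rightarrow> 'a" where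
  "RL c f t = (if c = 0 then f t
     else (1 / Gamma c) *\<^sub>R integral {0..t} (\<lambda>s. (t - s) powr (c - 1) *\<^sub>R f s))"

lemma Gamma_real_nonzero: "0 < x \<Longrightarrow> Gamma (x :: real) \<noteq> 0"
  using Gamma_real_pos[of x] by (metis less_irrefl)

lemma RL_0 [simp]: "RL 0 f = f"
  by (simp add: RL_def fun_eq_iff)

lemma continuous_on_initial: "continuous_on {0..T} f \<Longrightarrow> t \<le> T \<Longrightarrow> continuous_on {0..t::real} f"
  by (rule continuous_on_subset) auto

lemma has_integral_Beta_scaled:
  fixes a b t :: real
  assumes "0 < a" "0 < b" "0 \<le> t"
  shows "((\<lambda>s. (t - s) powr (a - 1) * s powr (b - 1)) has_integral
           Beta a b * t powr (a + b - 1)) {0..t}"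
proof (cases "t = 0")
  case True
  then show ?thesis by (simp add: has_integral_refl)
next
  case False
  with assms have t: "0 < t" by simp
  have img: "(\<lambda>x. x / (1 / t)) ` {0..1} = {0..t}"
    using t image_mult_atLeastAtMost[of t 0 1] by (simp add: mult.commute)
  have "((\<lambda>s. (1 / t * s) powr (b - 1) * (1 - 1 / t * s) powr (a - 1)) has_integral
          t *\<^sub>R Beta b a) {0..t}"
    using has_integral_stretch_real[OF has_integral_Beta_real[OF assms(2,1)], of "1 / t"] t
    unfolding img by simp
  then have scaled: "((\<lambda>s. t powr (a + b - 2) *
        ((1 / t * s) powr (b - 1) * (1 - 1 / t * s) powr (a - 1))) has_integral
          t powr (a + b - 2) * (t *\<^sub>R Beta b a)) {0..t}"
    by (rule has_integral_mult_right)
  have const: "t powr (a + b - 2) * (t *\<^sub>R Beta b a) = Beta a b * t powr (a + b - 1)"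
  proof -
    have "t powr (a + b - 2) * t = t powr (a + b - 1)"
      using t powr_add[of t "a + b - 2" 1] by (simp add: algebra_simps)
    then show ?thesis by (simp add: Beta_commute algebra_simps)
  qed
  have "t powr (a + b - 2) * ((1 / t * s) powr (b - 1) * (1 - 1 / t * s) powr (a - 1))
      = (t - s) powr (a - 1) * s powr (b - 1)" if "s \<in> {0..t}" for s
  proof -
    have e: "1 / t * s = s / t" "1 - s / t = (t - s) / t"
      using t by (auto simp: field_simps)
    have "t powr (a + b - 2) = t powr (a - 1) * t powr (b - 1)"
      by (simp add: powr_add[symmetric])
    moreover have pw: "(s / t) powr (b - 1) = s powr (b - 1) / t powr (b - 1)"
      "((t - s) / t) powr (a - 1) = (t - s) powr (a - 1) / t powr (a - 1)"
      using t that by (auto intro!: powr_divide)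
    ultimately show ?thesis
      unfolding e pw using t by simp
  qed
  from has_integral_eq[OF this scaled] show ?thesis
    unfolding const .
qed

lemma has_integral_kernel:
  fixes c t :: real
  assumes "0 < c" "0 \<le> t"
  shows "((\<lambda>s. (t - s) powr (c - 1)) has_integral Gamma c * frac_power c t) {0..t}"
proof -
  have "((\<lambda>s. (t - s) powr (c - 1)) has_integral Beta c 1 * t powr c) {0..t}"
    using has_integral_Beta_scaled[of c 1 t] assms
    by (intro has_integral_spike_finite[of "{0}" _ "\<lambda>s. (t - s) powr (c - 1)" "\<lambda>s. (t - s) powr (c - 1) * s powr (1 - 1)"])
       auto
  then show ?thesis
    by (simp add: frac_power_def Beta_def)
qed

lemma kernel_absolutely_integrable:
  fixes f :: "real \<Rightarrow> 'a::euclidean_space"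
  assumes "0 < c" "0 \<le> t" "continuous_on {0..t} f"
  shows "(\<lambda>s. (t - s) powr (c - 1) *\<^sub>R f s) absolutely_integrable_on {0..t}"
proof (rule absolutely_integrable_bounded_measurable_product[of "\<lambda>x r. r *\<^sub>R x"])
  show "bilinear (\<lambda>(x::'a) (r::real). r *\<^sub>R x)"
    by (auto simp: bilinear_def linear_iff algebra_simps)
  show "f \<in> borel_measurable (lebesgue_on {0..t})"
    by (rule continuous_imp_measurable_on_sets_lebesgue) (use assms in auto)
  show "bounded (f ` {0..t})"
    using assms by (intro compact_imp_bounded compact_continuous_image) auto
  show "(\<lambda>s. (t - s) powr (c - 1)) absolutely_integrable_on {0..t}"
    by (rule nonnegative_absolutely_integrable_1)
       (use has_integral_kernel[OF assms(1,2)] in \<open>auto simp: integrable_on_def\<close>)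
qed auto

lemmas kernel_integrable = kernel_absolutely_integrable[THEN set_lebesgue_integral_eq_integral(1)]

text \<open>The point \<open>0\<close> can be ignored because it is negligible.  This matters because the
  differential equation is only assumed for positive times, and because \<open>frac_power 0\<close> is the
  constant \<open>1\<close> at positive times but not at \<open>0\<close>, where \<open>0 powr 0 = 0\<close>.\<close>
lemma RL_cong:
  assumes "c \<noteq> 0 \<or> 0 < t" "\<And>s. 0 < s \<Longrightarrow> s \<le> t \<Longrightarrow> f s = h s"
  shows "RL c f t = RL c h t"
proof (cases "c = 0")
  case True
  then show ?thesis using assms by auto
next
  case False
  have "integral {0..t} (\<lambda>s. (t - s) powr (c - 1) *\<^sub>R f s)
      = integral {0..t} (\<lambda>s. (t - s) powr (c - 1) *\<^sub>R h s)"
    by (rule integral_spike[of "{0}"]) (use assms(2) in auto)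
  with False show ?thesis by (simp add: RL_def)
qed

lemma RL_add:
  assumes "0 \<le> c" "0 \<le> t" "continuous_on {0..t} f" "continuous_on {0..t} h"
  shows "RL c (\<lambda>s. f s + h s) t = RL c f t + RL c h t"
  using assms kernel_integrable[of c t f] kernel_integrable[of c t h]
  by (auto simp: RL_def scaleR_add_right integral_add)

lemma RL_bounded_linear:
  assumes "bounded_linear L" "0 \<le> c" "0 \<le> t" "continuous_on {0..t} f"
  shows "RL c (\<lambda>s. L (f s)) t = L (RL c f t)"
proof (cases "c = 0")
  case False
  have "integral {0..t} (L \<circ> (\<lambda>s. (t - s) powr (c - 1) *\<^sub>R f s))
      = L (integral {0..t} (\<lambda>s. (t - s) powr (c - 1) *\<^sub>R f s))"
    using assms False by (intro integral_linear kernel_integrable) auto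
  with False show ?thesis
    by (simp add: RL_def o_def linear_scale[OF bounded_linear.linear[OF assms(1)]])
qed simp

lemma RL_diff:
  assumes "0 \<le> c" "0 \<le> t" "continuous_on {0..t} f" "continuous_on {0..t} h"
  shows "RL c (\<lambda>s. f s - h s) t = RL c f t - RL c h t"
  using assms kernel_integrable[of c t f] kernel_integrable[of c t h]
  by (auto simp: RL_def scaleR_diff_right integral_diff)

text \<open>The integral is a Beta function, whose Gamma factors cancel against those in the
  normalisations of \<open>RL\<close> and \<open>frac_power\<close>.\<close>
lemma RL_frac_power:
  assumes "0 < a" "0 \<le> b" "0 \<le> t"
  shows "RL a (\<lambda>s. frac_power b s *\<^sub>R v) t = frac_power (a + b) t *\<^sub>R v"
proof -
  have G: "Gamma a \<noteq> 0" "Gamma (b + 1) \<noteq> 0"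
    using assms by (auto intro!: Gamma_real_nonzero)
  have "((\<lambda>s. (t - s) powr (a - 1) * s powr b) has_integral Beta a (b + 1) * t powr (a + b)) {0..t}"
    using has_integral_Beta_scaled[of a "b + 1" t] assms by (simp add: algebra_simps)
  then have "((\<lambda>s. (((t - s) powr (a - 1) * s powr b) / Gamma (b + 1)) *\<^sub>R v) has_integral
     (Beta a (b + 1) * t powr (a + b) / Gamma (b + 1)) *\<^sub>R v) {0..t}"
    by (intro has_integral_scaleR_left has_integral_divide)
  moreover have "Beta a (b + 1) * t powr (a + b) / Gamma (b + 1) = Gamma a * frac_power (a + b) t"
    using G by (simp add: Beta_def frac_power_def add.assoc field_simps)
  ultimately have "((\<lambda>s. (t - s) powr (a - 1) *\<^sub>R (frac_power b s *\<^sub>R v)) has_integral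
     (Gamma a * frac_power (a + b) t) *\<^sub>R v) {0..t}"
    by (simp add: frac_power_def)
  then show ?thesis
    using assms G by (simp add: RL_def integral_unique)
qed

lemma RL_const:
  assumes "0 \<le> c" "0 < t"
  shows "RL c (\<lambda>_. v) t = frac_power c t *\<^sub>R v"
proof (cases "c = 0")
  case True
  then show ?thesis using assms by (simp add: frac_power_def)
next
  case False
  have "RL c (\<lambda>_. v) t = RL c (\<lambda>s. frac_power 0 s *\<^sub>R v) t"
    by (rule RL_cong) (use assms in \<open>auto simp: frac_power_def\<close>)
  then show ?thesis
    using RL_frac_power[of c 0 t v] assms False by simp
qed

lemma RL_norm_le:
  assumes "0 \<le> c" "c \<noteq> 0 \<or> 0 < t" "0 \<le> t" "continuous_on {0..t} f"
    and "\<And>s. 0 \<le> s \<Longrightarrow> s \<le> t \<Longrightarrow> norm (f s) \<le> M"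
  shows "norm (RL c f t) \<le> M * frac_power c t"
proof (cases "c = 0")
  case True
  then show ?thesis using assms by (simp add: frac_power_def)
next
  case False
  then have c: "0 < c" using assms by simp
  have k: "((\<lambda>s. M * (t - s) powr (c - 1)) has_integral M * (Gamma c * frac_power c t)) {0..t}"
    by (intro has_integral_mult_right has_integral_kernel c assms)
  have "norm (integral {0..t} (\<lambda>s. (t - s) powr (c - 1) *\<^sub>R f s))
      \<le> integral {0..t} (\<lambda>s. M * (t - s) powr (c - 1))"
  proof (rule integral_norm_bound_integral)
    show "norm ((t - s) powr (c - 1) *\<^sub>R f s) \<le> M * (t - s) powr (c - 1)" if "s \<in> {0..t}" for s
      using assms(5)[of s] that by (simp add: mult.commute[of M] mult_left_mono)
  qed (intro kernel_integrable c assms has_integral_integrable[OF k])+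
  also have "\<dots> = Gamma c * (M * frac_power c t)"
    using integral_unique[OF k] by simp
  finally show ?thesis
    using c Gamma_real_pos[OF c] by (simp add: RL_def pos_divide_le_eq mult.commute)
qed

lemma frac_power_mono: "0 \<le> c \<Longrightarrow> 0 \<le> s \<Longrightarrow> s \<le> t \<Longrightarrow> frac_power c s \<le> frac_power c t"
  unfolding frac_power_def by (intro divide_right_mono powr_mono2) (auto intro!: Gamma_real_nonneg)

lemma continuous_on_frac_power:
  assumes "0 < c"
  shows "continuous_on {0..} (frac_power c)"
proof -
  have "Gamma (c + 1) \<noteq> 0" using assms by (intro Gamma_real_nonzero) simp
  with assms show ?thesis
    unfolding frac_power_def by (intro continuous_intros continuous_on_powr') auto
qed

text \<open>The Weierstrass approximation theorem as an induction rule.  It reduces the continuity of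
  \<open>I^c f\<close> and the semigroup law to the explicit integrals of monomials.\<close>
lemma weierstrass_induct [consumes 1, case_names monomial add limit]:
  fixes f :: "real \<Rightarrow> 'a::euclidean_space"
  assumes "continuous_on {a..b} f"
    and monomial: "\<And>i v. P (\<lambda>x. x ^ i *\<^sub>R v)"
    and add: "\<And>f g. continuous_on {a..b} f \<Longrightarrow> continuous_on {a..b} g \<Longrightarrow> P f \<Longrightarrow> P g
                \<Longrightarrow> P (\<lambda>x. f x + g x)"
    and limit: "\<And>f. continuous_on {a..b} f \<Longrightarrow> 
       (\<And>e. 0 < e \<Longrightarrow> \<exists>p. continuous_on {a..b} p \<and> P p \<and> (\<forall>x\<in>{a..b}. norm (f x - p x) \<le> e)) \<Longrightarrow> P f"
  shows "P f"
proof (rule limit[OF assms(1)])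
  fix e :: real assume "0 < e"
  then obtain p where p: "polynomial_function p" "\<And>x. x \<in> {a..b} \<Longrightarrow> norm (f x - p x) < e"
    using Stone_Weierstrass_polynomial_function[of "{a..b}" f e] assms(1) by auto
  have sum: "P (\<lambda>x. \<Sum>j\<in>J. h j x)" 
    if "finite J" "\<And>j. j \<in> J \<Longrightarrow> P (h j)" "\<And>j. j \<in> J \<Longrightarrow> continuous_on {a..b} (h j)" 
    for J :: "'j set" and h
    using that
  proof (induction J rule: finite_induct)
    case empty
    show ?case using monomial[of 0 0] by simp
  next
    case (insert j J)
    then show ?case
      using add[of "h j" "\<lambda>x. \<Sum>j\<in>J. h j x"] by (simp add: continuous_on_sum)
  qed
  have "P (\<lambda>x. (p x \<bullet> v) *\<^sub>R v)" if "v \<in> Basis" for v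
  proof -
    have "real_polynomial_function (\<lambda>x. p x \<bullet> v)"
      using p(1) unfolding polynomial_function_iff_Basis_inner using that by blast
    then obtain c n where "(\<lambda>x. p x \<bullet> v) = (\<lambda>x. \<Sum>i\<le>n. c i * x ^ i)"
      unfolding real_polynomial_function_iff_sum by blast
    then have "(\<lambda>x. (p x \<bullet> v) *\<^sub>R v) = (\<lambda>x. \<Sum>i\<le>n. x ^ i *\<^sub>R (c i *\<^sub>R v))"
      by (simp add: fun_eq_iff scaleR_sum_left mult.commute)
    then show ?thesis
      using sum[of "{..n}" "\<lambda>i x. x ^ i *\<^sub>R (c i *\<^sub>R v)"] monomial
      by (simp add: continuous_intros del: scaleR_scaleR)
  qed
  moreover have cp: "continuous_on {a..b} p"
    using p(1) by (rule continuous_on_polymonial_function)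
  ultimately have "P (\<lambda>x. \<Sum>v\<in>Basis. (p x \<bullet> v) *\<^sub>R v)"
    by (intro sum) (auto intro!: continuous_intros)
  then have "P p" by (simp add: euclidean_representation)
  with cp p(2) show "\<exists>p. continuous_on {a..b} p \<and> P p \<and> (\<forall>x\<in>{a..b}. norm (f x - p x) \<le> e)"
    by (meson less_imp_le)
qed

lemma RL_monomial:
  assumes "0 < c" "0 \<le> t"
  shows "RL c (\<lambda>s. s ^ i *\<^sub>R v) t = frac_power (c + i) t *\<^sub>R (fact i *\<^sub>R v)"
proof -
  have "RL c (\<lambda>s. s ^ i *\<^sub>R v) t = RL c (\<lambda>s. frac_power i s *\<^sub>R (fact i *\<^sub>R v)) t"
    by (rule RL_cong)
       (use assms in \<open>auto simp: frac_power_def powr_realpow add.commute[of _ 1] Gamma_fact\<close>)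
  then show ?thesis using RL_frac_power[of c i t] assms by (simp del: scaleR_scaleR)
qed

lemma uniformly_approximable_continuous:
  fixes f :: "'a::topological_space \<Rightarrow> 'b::metric_space"
  assumes "\<And>e. 0 < e \<Longrightarrow> \<exists>p. continuous_on S p \<and> (\<forall>x\<in>S. dist (p x) (f x) < e)"
  shows "continuous_on S f"
proof -
  have "\<exists>p. continuous_on S p \<and> (\<forall>x\<in>S. dist (p x) (f x) < inverse (Suc n))" for n
    by (rule assms) simp
  then obtain p where p: "\<And>n. continuous_on S (p n)"
    "\<And>n x. x \<in> S \<Longrightarrow> dist (p n x) (f x) < inverse (Suc n)" by metis
  have "uniform_limit S p f sequentially"
  proof (rule uniform_limitI)
    fix e :: real assume "0 < e"
    then have "\<forall>\<^sub>F n in sequentially. inverse (real (Suc n)) < e"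
      by (rule order_tendstoD(2)[OF LIMSEQ_inverse_real_of_nat])
    then show "\<forall>\<^sub>F n in sequentially. \<forall>x\<in>S. dist (p n x) (f x) < e"
      by eventually_elim (use p(2) less_trans in blast)
  qed
  then show ?thesis
    using p(1) by (intro uniform_limit_theorem[where f = p and F = sequentially]) auto
qed

text \<open>\<open>I^c\<close> is bounded for the uniform norm and maps monomials to continuous functions, so its
  values on uniform limits of polynomials are uniform limits of continuous functions.\<close>
lemma continuous_on_RL:
  fixes f :: "real \<Rightarrow> 'a::euclidean_space"
  assumes "continuous_on {0..T} f" "0 \<le> c"
  shows "continuous_on {0..T} (RL c f)"
proof (cases "c = 0")
  case True
  then show ?thesis using assms by simp
next
  case False
  with assms have c: "0 < c" by simp
  from assms(1) show ?thesis
  proof (induction rule: weierstrass_induct)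
    case (monomial i v)
    have "continuous_on {0..T} (\<lambda>t. frac_power (c + i) t *\<^sub>R (fact i *\<^sub>R v))"
      by (intro continuous_intros continuous_on_subset[OF continuous_on_frac_power]) (use c in auto)
    then show ?case
      by (rule continuous_on_eq) (use c in \<open>auto simp: RL_monomial simp del: scaleR_scaleR\<close>)
  next
    case (add f g)
    have "continuous_on {0..T} (\<lambda>t. RL c f t + RL c g t)"
      using add by (intro continuous_intros)
    moreover have "RL c f t + RL c g t = RL c (\<lambda>x. f x + g x) t" if "t \<in> {0..T}" for t
    proof -
      have "continuous_on {0..t} f" "continuous_on {0..t} g"
        using that by (auto intro: continuous_on_initial[OF add(1)] continuous_on_initial[OF add(2)])
      then show ?thesis using that c by (simp add: RL_add)
    qed
    ultimately show ?case
      by (rule continuous_on_eq)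
  next
    case (limit f)
    have "\<exists>p. continuous_on {0..T} p \<and> (\<forall>t\<in>{0..T}. dist (p t) (RL c f t) < e)" if e: "0 < e" for e
    proof -
      define d where "d = e / (frac_power c T + 1)"
      have pos: "0 < frac_power c T + 1" using frac_power_nonneg[of c T] c by simp
      then have d: "0 < d" using e by (simp add: d_def)
      from limit(2)[OF d] obtain p where p: "continuous_on {0..T} p" "continuous_on {0..T} (RL c p)"
        "\<And>x. x \<in> {0..T} \<Longrightarrow> norm (f x - p x) \<le> d" by blast
      have sub: "continuous_on {0..s} f" "continuous_on {0..s} p" if "s \<le> T" for s
        using that by (rule continuous_on_initial[OF limit(1)], rule continuous_on_initial[OF p(1)])
      have "dist (RL c p t) (RL c f t) < e" if t: "t \<in> {0..T}" for t
      proof -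
        have "norm (RL c f t - RL c p t) = norm (RL c (\<lambda>s. f s - p s) t)"
          using t c by (subst RL_diff) (auto simp: sub)
        also have "\<dots> \<le> d * frac_power c t"
          using t c by (intro RL_norm_le p continuous_on_diff sub) auto
        also have "\<dots> \<le> d * frac_power c T"
          using t c d by (intro mult_left_mono frac_power_mono) auto
        also have "\<dots> < d * (frac_power c T + 1)" using d by (intro mult_strict_left_mono) auto
        also have "\<dots> = e" using pos by (simp add: d_def)
        finally show ?thesis by (simp add: dist_norm norm_minus_commute)
      qed
      with p(2) show ?thesis by blast
    qed
    then show ?case
      by (rule uniformly_approximable_continuous)
  qed
qed

text \<open>On monomials both sides are the same fractional monomial; both sides are bounded linear
  in \<open>f\<close> for the uniform norm, which settles the rest by density.\<close>
lemma RL_semigroup: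
  fixes f :: "real \<Rightarrow> 'a::euclidean_space"
  assumes "continuous_on {0..T} f" "0 \<le> a" "0 \<le> b" "t \<in> {0..T}"
  shows "RL a (RL b f) t = RL (a + b) f t"
proof (cases "a = 0 \<or> b = 0")
  case True
  then show ?thesis by auto
next
  case False
  with assms have ab: "0 < a" "0 < b" by auto
  have "\<forall>t\<in>{0..T}. RL a (RL b f) t = RL (a + b) f t"
    using assms(1)
  proof (induction rule: weierstrass_induct)
    case (monomial i v)
    show ?case
    proof
      fix t assume t: "t \<in> {0..T}"
      have "RL a (RL b (\<lambda>x. x ^ i *\<^sub>R v)) t = RL a (\<lambda>s. frac_power (b + i) s *\<^sub>R (fact i *\<^sub>R v)) t"
        by (rule RL_cong) (use ab in \<open>auto simp: RL_monomial simp del: scaleR_scaleR\<close>)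
      also have "\<dots> = RL (a + b) (\<lambda>x. x ^ i *\<^sub>R v) t"
        using t ab by (simp add: RL_frac_power RL_monomial add.assoc del: scaleR_scaleR)
      finally show "RL a (RL b (\<lambda>x. x ^ i *\<^sub>R v)) t = RL (a + b) (\<lambda>x. x ^ i *\<^sub>R v) t" .
    qed
  next
    case (add f g)
    show ?case
    proof
      fix t assume t: "t \<in> {0..T}"
      have sub: "continuous_on {0..s} f" "continuous_on {0..s} g" if "s \<le> T" for s
        using that by (rule continuous_on_initial[OF add(1)], rule continuous_on_initial[OF add(2)])
      have "RL a (RL b (\<lambda>x. f x + g x)) t = RL a (\<lambda>s. RL b f s + RL b g s) t"
        by (rule RL_cong) (use ab t in \<open>auto intro!: RL_add sub\<close>)
      also have "\<dots> = RL a (RL b f) t + RL a (RL b g) t"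
        using t ab by (simp add: RL_add continuous_on_RL sub)
      also have "\<dots> = RL (a + b) (\<lambda>x. f x + g x) t"
        using t ab add(3,4) by (simp add: RL_add sub)
      finally show "RL a (RL b (\<lambda>x. f x + g x)) t = RL (a + b) (\<lambda>x. f x + g x) t" .
    qed
  next
    case (limit f)
    show ?case
    proof
      fix t assume t: "t \<in> {0..T}"
      define K where "K = frac_power b t * frac_power a t + frac_power (a + b) t"
      have sub: "continuous_on {0..s} f" if "s \<le> T" for s
        using that by (rule continuous_on_initial[OF limit(1)])
      have K: "0 \<le> K" using ab by (simp add: K_def frac_power_nonneg)
      have "norm (RL a (RL b f) t - RL (a + b) f t) \<le> K * e" if e: "0 < e" for e
      proof -
        obtain p where p: "continuous_on {0..T} p" 
          "RL a (RL b p) t = RL (a + b) p t"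
          "\<And>x. x \<in> {0..T} \<Longrightarrow> norm (f x - p x) \<le> e" using limit(2)[OF e] t by blast
        have subp: "continuous_on {0..s} p" if "s \<le> T" for s
          using that by (rule continuous_on_initial[OF p(1)])
        have diff: "RL c f s - RL c p s = RL c (\<lambda>s. f s - p s) s" if "0 \<le> s" "s \<le> t" "0 \<le> c" for s c
          using that t by (intro RL_diff[symmetric] sub subp) auto
        have le: "norm (RL c f s - RL c p s) \<le> e * frac_power c t" if "0 \<le> s" "s \<le> t" "0 < c" for s c
        proof -
          have "norm (RL c f s - RL c p s) \<le> e * frac_power c s"
            unfolding diff[OF that(1,2) less_imp_le[OF that(3)]]
            using that t by (intro RL_norm_le p continuous_intros sub subp) auto
          also have "\<dots> \<le> e * frac_power c t"
            using that e by (intro mult_left_mono frac_power_mono) auto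
          finally show ?thesis .
        qed
        have "RL a (RL b f) t - RL a (RL b p) t = RL a (\<lambda>s. RL b f s - RL b p s) t"
          using t ab by (intro RL_diff[symmetric] continuous_on_RL sub subp) auto
        also have "norm \<dots> \<le> e * frac_power b t * frac_power a t"
          using t ab le by (intro RL_norm_le continuous_intros continuous_on_RL sub subp) auto
        finally have "norm (RL a (RL b f) t - RL (a + b) p t) \<le> e * frac_power b t * frac_power a t"
          by (simp add: p(2))
        moreover have "norm (RL (a + b) f t - RL (a + b) p t) \<le> e * frac_power (a + b) t"
          using t ab by (intro le) auto
        ultimately show ?thesis
          unfolding K_def using norm_triangle_ineq4[of "RL a (RL b f) t - RL (a + b) p t" "RL (a + b) f t - RL (a + b) p t"]
          by (simp add: algebra_simps)
      qed
      then have "norm (RL a (RL b f) t - RL (a + b) f t) \<le> 0 + e" if "0 < e" for e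
      proof -
        have "norm (RL a (RL b f) t - RL (a + b) f t) \<le> K * (e / (K + 1))"
          using K that by (intro \<open>\<And>e. 0 < e \<Longrightarrow> _ \<le> K * e\<close>) auto
        also have "\<dots> \<le> e"
          using K that by (simp add: field_simps)
        finally show ?thesis by simp
      qed
      then have "norm (RL a (RL b f) t - RL (a + b) f t) \<le> 0"
        by (rule field_le_epsilon)
      then show "RL a (RL b f) t = RL (a + b) f t" by simp
    qed
  qed
  with assms(4) show ?thesis by blast
qed

section \<open>From Caputo derivatives to the Volterra equation\<close>

lemma deriv_on_0 [simp]: "deriv_on J 0 y = y"
  by (simp add: deriv_on_def fun_eq_iff)

lemma C_k_on_continuous:
  assumes "C_k_on n J y" "i \<le> n"
  shows "continuous_on J (deriv_on J i y)"
proof (cases "i = n")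
  case False
  with assms show ?thesis
    by (intro differentiable_imp_continuous_on) (auto simp: C_k_on_def differentiable_on_def)
qed (use assms in \<open>simp add: C_k_on_def\<close>)

text \<open>Integrating the equation to order \<open>\<alpha>\<close>: \<open>I^\<alpha> I^(2-\<alpha>) y'' = I^1 I^1 y''\<close> returns \<open>z\<close> minus its linear
  part, and \<open>I^\<alpha> I^(1-\<beta>) y' = I^(\<alpha>-\<beta>) I^1 y' = I^(\<alpha>-\<beta>) z\<close>.\<close>
lemma cauchy_problem_volterra:
  fixes A B :: "real^'n^'n" and y g :: "real \<Rightarrow> real^'n"
  assumes ord: "1 < \<alpha>" "\<alpha> \<le> 2" "0 < \<beta>" "\<beta> \<le> 1"
    and y: "C_k_on 2 {0..T} y"
    and eq: "\<And>t. 0 < t \<Longrightarrow> t \<le> T \<Longrightarrow>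
       caputo {0..T} \<alpha> y t - A *v caputo {0..T} \<beta> y t - B *v y t = g t"
    and t: "0 \<le> t" "t \<le> T"
  defines "z \<equiv> \<lambda>s. y s - y 0"
  shows "z t = RL 1 (\<lambda>_. deriv_on {0..T} 1 y 0) t + RL \<alpha> (\<lambda>s. g s + B *v y 0) t
     + A *v RL (\<alpha> - \<beta>) z t + B *v RL \<alpha> z t"
proof -
  define y1 y2 where "y1 = deriv_on {0..T} 1 y" and "y2 = deriv_on {0..T} 2 y"
  have cont: "continuous_on {0..T} y1" "continuous_on {0..T} y2" "continuous_on {0..T} y"
    using C_k_on_continuous[OF y, of 0] C_k_on_continuous[OF y, of 1] C_k_on_continuous[OF y, of 2]
    by (simp_all add: y1_def y2_def)
  then have contz: "continuous_on {0..T} z" by (auto simp: z_def intro!: continuous_intros)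
  have sub: "continuous_on {0..t} z" "continuous_on {0..t} y1"
    "continuous_on {0..t} (RL (2 - \<alpha>) y2)" "continuous_on {0..t} (RL (1 - \<beta>) y1)"
    using ord by (intro continuous_on_initial[OF _ t(2)] continuous_on_RL cont contz; simp)+
  have RL_1: "RL 1 u' s = u s - u 0"
    if s: "0 \<le> s" "s \<le> T" and u': "continuous_on {0..T} u'"
      and deriv: "\<And>r. r \<in> {0..T} \<Longrightarrow> (u has_vector_derivative u' r) (at r within {0..T})"
    for u u' :: "real \<Rightarrow> real^'n" and s
  proof -
    have "(u has_vector_derivative u' r) (at r within {0..s})" if "r \<in> {0..s}" for r
      by (rule has_vector_derivative_within_subset[OF deriv]) (use that s in auto)
    then have "(u' has_integral u s - u 0) {0..s}"
      by (intro fundamental_theorem_of_calculus s)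
    moreover have "integral {0..s} (\<lambda>r. (s - r) powr (1 - 1) *\<^sub>R u' r) = integral {0..s} u'"
      by (rule integral_spike[of "{s}"]) auto
    ultimately show ?thesis by (simp add: RL_def integral_unique)
  qed
  have deriv: "(deriv_on {0..T} i y has_vector_derivative deriv_on {0..T} (Suc i) y r) (at r within {0..T})"
    if "i < 2" "r \<in> {0..T}" for i r
    using y that by (simp add: C_k_on_def deriv_on_def vector_derivative_works)
  have int_y1: "RL 1 y1 s = z s" if "0 \<le> s" "s \<le> T" for s
    using RL_1[OF that cont(1), of y] deriv[of 0] by (simp add: y1_def z_def)
  have int_y2: "RL 1 y2 s = y1 s - y1 0" if "0 \<le> s" "s \<le> T" for s
    using RL_1[OF that cont(2), of y1] deriv[of 1] by (simp add: y1_def y2_def numeral_2_eq_2)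
  have caputo_RL: "caputo {0..T} \<nu> y s = RL (real N - \<nu>) (deriv_on {0..T} N y) s"
    if "real N - 1 < \<nu>" "\<nu> \<le> real N" for \<nu> N s
  proof -
    have "\<lceil>\<nu>\<rceil> = int N" using that by (intro ceiling_unique) auto
    then show ?thesis by (simp add: caputo_def RL_def Let_def)
  qed
  have cap: "caputo {0..T} \<alpha> y s = RL (2 - \<alpha>) y2 s" "caputo {0..T} \<beta> y s = RL (1 - \<beta>) y1 s" for s
    using caputo_RL[of 2 \<alpha>] caputo_RL[of 1 \<beta>] ord by (simp_all add: y1_def y2_def)
  have sub': "continuous_on {0..t} (\<lambda>s. A *v RL (1 - \<beta>) y1 s)" "continuous_on {0..t} (\<lambda>s. B *v z s)"
    by (intro bounded_linear.continuous_on[OF matrix_vector_mul_bounded_linear] sub)+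
  have "RL \<alpha> (\<lambda>s. g s + B *v y 0) t
      = RL \<alpha> (\<lambda>s. RL (2 - \<alpha>) y2 s - A *v RL (1 - \<beta>) y1 s - B *v z s) t"
  proof (rule RL_cong)
    fix s assume "0 < s" "s \<le> t"
    then have "g s = RL (2 - \<alpha>) y2 s - A *v RL (1 - \<beta>) y1 s - B *v y s"
      using eq[of s] t(2) by (simp add: cap)
    then show "g s + B *v y 0 = RL (2 - \<alpha>) y2 s - A *v RL (1 - \<beta>) y1 s - B *v z s"
      by (simp add: z_def matrix_vector_mult_diff_distrib)
  qed (use ord in auto)
  also have "\<dots> = RL \<alpha> (RL (2 - \<alpha>) y2) t - A *v RL \<alpha> (RL (1 - \<beta>) y1) t - B *v RL \<alpha> z t"
    using ord t
    by (simp add: RL_diff RL_bounded_linear[OF matrix_vector_mul_bounded_linear] sub sub'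
        continuous_on_diff)
  also have "RL \<alpha> (RL (2 - \<alpha>) y2) t = RL 1 (RL 1 y2) t"
    using ord t cont by (simp add: RL_semigroup[of T])
  also have "\<dots> = RL 1 (\<lambda>s. y1 s - y1 0) t"
    by (rule RL_cong) (use int_y2 t in auto)
  also have "\<dots> = z t - RL 1 (\<lambda>_. y1 0) t"
    using t int_y1 by (simp add: RL_diff sub)
  also have "RL \<alpha> (RL (1 - \<beta>) y1) t = RL (\<alpha> - \<beta>) (RL 1 y1) t"
    using ord t cont by (simp add: RL_semigroup[of T] algebra_simps)
  also have "\<dots> = RL (\<alpha> - \<beta>) z t"
    by (rule RL_cong) (use int_y1 t ord in auto)
  finally show ?thesis
    by (simp add: y1_def)
qed

section \<open>Matrix powers and the terms of the series\<close>

lemma bounded_bilinear_matrix_vector_mult: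
  "bounded_bilinear ((*v) :: real^'n^'m \<Rightarrow> real^'n \<Rightarrow> real^'m)"
  unfolding bilinear_conv_bounded_bilinear[symmetric] bilinear_def linear_iff
  by (simp add: matrix_vector_right_distrib matrix_vector_mult_add_rdistrib
      scaleR_matrix_vector_assoc matrix_vector_mult_scaleR)

lemma bounded_bilinear_matrix_matrix_mult:
  "bounded_bilinear ((**) :: real^'n^'m \<Rightarrow> real^'k^'n \<Rightarrow> real^'k^'m)"
  unfolding bilinear_conv_bounded_bilinear[symmetric] bilinear_def linear_iff
  by (simp add: matrix_add_ldistrib matrix_matrix_mult_def vec_eq_iff sum.distrib sum_distrib_left
      scaleR_sum_right ring_distribs algebra_simps)

text \<open>A bilinear bound \<open>K\<close> for the matrix product replaces submultiplicativity of the norm; it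
  only enlarges the ratio \<open>p\<close>.\<close>
lemma matpow_norm_le:
  fixes A :: "real^'n^'n"
  obtains D p where "0 \<le> D" "0 \<le> p" "\<And>k. norm (matpow A k) \<le> D * p ^ k"
proof -
  obtain K where K: "0 < K" "\<And>(X :: real^'n^'n) (Y :: real^'n^'n). norm (X ** Y) \<le> norm X * norm Y * K"
    using bounded_bilinear.pos_bounded[OF bounded_bilinear_matrix_matrix_mult] by blast
  have "norm (matpow A k) \<le> norm (mat 1 :: real^'n^'n) * (K * norm A) ^ k" for k
  proof (induction k)
    case (Suc k)
    have "norm (matpow A (Suc k)) \<le> norm A * norm (matpow A k) * K"
      using K(2) by simp
    also have "\<dots> \<le> norm A * (norm (mat 1 :: real^'n^'n) * (K * norm A) ^ k) * K"
      using K(1) by (intro mult_right_mono mult_left_mono Suc) auto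
    finally show ?case by (simp add: algebra_simps)
  qed simp
  then show thesis
    using K(1) by (intro that[of "norm (mat 1 :: real^'n^'n)" "K * norm A"]) auto
qed

lemma matpow_commute:
  assumes "A ** B = B ** A"
  shows "matpow A k ** B = B ** matpow A k"
proof (induction k)
  case (Suc k)
  have "matpow A (Suc k) ** B = A ** (matpow A k ** B)"
    by (simp add: matrix_mul_assoc)
  also have "\<dots> = (A ** B) ** matpow A k"
    by (simp add: Suc matrix_mul_assoc)
  also have "\<dots> = B ** matpow A (Suc k)"
    by (simp add: assms matrix_mul_assoc)
  finally show ?case .
qed simp

text \<open>The terms of a bivariate matrix Mittag-Leffler function times \<open>t powr c\<close>.  In the theorem,
  the series for \<open>\<eta>'\<close> is the case \<open>c = 1\<close>, the one for \<open>\<eta>\<close> is the case \<open>c = \<alpha>\<close> multiplied by \<open>B0\<close>,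
  and the convolution kernel is the case \<open>c = \<alpha> - 1\<close>.\<close>
definition mittag_leffler_term :: "real^'n^'n \<Rightarrow> real^'n^'n \<Rightarrow> real \<Rightarrow> real \<Rightarrow> real \<Rightarrow> real \<Rightarrow> nat \<Rightarrow> nat \<Rightarrow> real^'n^'n" where
  "mittag_leffler_term A B a b c t k m =
    (real ((k + m) choose m) * frac_power (real k * a + real m * b + c) t) *\<^sub>R (matpow A k ** matpow B m)"

text \<open>The binomial coefficient is at most \<open>2^(k+m)\<close>, so it suffices to choose \<open>R = T / x\<close> in
  the estimate for fractional monomials with \<open>x\<close> so small that \<open>p x^a\<close> and \<open>q x^b\<close> are at most \<open>1/4\<close>,
  where \<open>p\<close> and \<open>q\<close> are the geometric ratios of the powers of \<open>A\<close> and \<open>B\<close>.  Because \<open>x \<le> 1\<close>, the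
  constant does not depend on \<open>c\<close>.\<close>
lemma mittag_leffler_term_bound:
  fixes A B :: "real^'n^'n"
  assumes "0 < a" "0 < b" "0 < T"
  obtains C where "0 \<le> C" "\<And>c t k m. 0 \<le> c \<Longrightarrow> 0 \<le> t \<Longrightarrow> t \<le> T \<Longrightarrow>
    norm (mittag_leffler_term A B a b c t k m) \<le> C * (1/2)^k * (1/2)^m"
proof -
  obtain K where K: "0 < K" "\<And>(X :: real^'n^'n) (Y :: real^'n^'n). norm (X ** Y) \<le> norm X * norm Y * K"
    using bounded_bilinear.pos_bounded[OF bounded_bilinear_matrix_matrix_mult] by blast
  obtain D p where p: "0 \<le> D" "0 \<le> p" "\<And>k. norm (matpow A k) \<le> D * p ^ k"
    using matpow_norm_le by blast
  obtain E q where q: "0 \<le> E" "0 \<le> q" "\<And>k. norm (matpow B k) \<le> E * q ^ k"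
    using matpow_norm_le by blast
  define x where "x = min 1 (min ((1 / (4 * p + 4)) powr (1 / a)) ((1 / (4 * q + 4)) powr (1 / b)))"
  have x: "0 < x" "x \<le> 1"
    using p(2) q(2) by (auto simp: x_def)
  have small: "r * x powr d \<le> 1 / 4" 
    if "0 \<le> r" "0 < d" "x \<le> (1 / (4 * r + 4)) powr (1 / d)" for r d
  proof -
    have "x powr d \<le> ((1 / (4 * r + 4)) powr (1 / d)) powr d"
      using that x by (intro powr_mono2) auto
    also have "\<dots> = 1 / (4 * r + 4)" using that by (simp add: powr_powr)
    finally have "r * x powr d \<le> r * (1 / (4 * r + 4))"
      using that(1) by (rule mult_left_mono)
    also have "\<dots> \<le> 1 / 4" using that(1) by (simp add: field_simps)
    finally show ?thesis .
  qed
  have pa: "p * x powr a \<le> 1 / 4"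
    using p assms by (intro small) (auto simp: x_def)
  have qb: "q * x powr b \<le> 1 / 4"
    using q assms by (intro small) (auto simp: x_def)
  define R where "R = T / x"
  have R: "0 < R" using x assms by (simp add: R_def)
  define C where "C = exp (R + 1) * (D * E * K)"
  have "norm (mittag_leffler_term A B a b c t k m) \<le> C * (1/2)^k * (1/2)^m"
    if ct: "0 \<le> c" "0 \<le> t" "t \<le> T" for c t k m
  proof -
    define u where "u = real k * a + real m * b + c"
    have u: "0 \<le> u" using ct assms by (simp add: u_def)
    have "t / R \<le> x" using ct x assms by (simp add: R_def field_simps)
    have "frac_power u t \<le> exp (R + 1) * (t / R) powr u"
      using u R ct by (intro frac_power_le) auto
    also have "\<dots> \<le> exp (R + 1) * x powr u"
      using \<open>t / R \<le> x\<close> ct R u by (intro mult_left_mono powr_mono2) auto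
    also have "x powr u = (x powr a) ^ k * (x powr b) ^ m * x powr c"
      using x by (simp add: u_def powr_add powr_powr powr_realpow[symmetric] mult.commute)
    also have "exp (R + 1) * \<dots> \<le> exp (R + 1) * ((x powr a) ^ k * (x powr b) ^ m * 1)"
      using x ct by (intro mult_left_mono) (auto simp: powr_le1)
    finally have fp_le: "frac_power u t \<le> exp (R + 1) * ((x powr a) ^ k * (x powr b) ^ m)" by simp
    have bin: "real ((k + m) choose m) \<le> 2 ^ k * 2 ^ m"
      using binomial_le_pow2[of "k + m" m] by (simp add: power_add flip: of_nat_le_iff[where 'a = real])
    have "norm (matpow A k ** matpow B m) \<le> norm (matpow A k) * norm (matpow B m) * K"
      by (rule K(2))
    also have "\<dots> \<le> (D * p ^ k) * (E * q ^ m) * K"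
      using K(1) p q by (intro mult_right_mono mult_mono) auto
    finally have M: "norm (matpow A k ** matpow B m) \<le> (D * p ^ k) * (E * q ^ m) * K" .
    have "norm (mittag_leffler_term A B a b c t k m)
        = real ((k + m) choose m) * frac_power u t * norm (matpow A k ** matpow B m)"
      using frac_power_nonneg[OF u] by (simp add: mittag_leffler_term_def u_def)
    also have "\<dots> \<le> (2 ^ k * 2 ^ m) * (exp (R + 1) * ((x powr a) ^ k * (x powr b) ^ m)) *
        ((D * p ^ k) * (E * q ^ m) * K)"
      using frac_power_nonneg[OF u] by (intro mult_mono bin fp_le M) (auto simp: p q)
    also have "\<dots> = C * ((2 * (p * x powr a)) ^ k * (2 * (q * x powr b)) ^ m)"
      by (simp add: C_def power_mult_distrib algebra_simps)
    also have "\<dots> \<le> C * ((1/2) ^ k * (1/2) ^ m)"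
      using pa qb p q K(1) by (intro mult_left_mono mult_mono power_mono) (auto simp: C_def)
    finally show ?thesis by (simp add: mult.assoc)
  qed
  moreover have "0 \<le> C" using p q K(1) by (simp add: C_def)
  ultimately show thesis using that by blast
qed

section \<open>Solving the Volterra equation by iteration\<close>

text \<open>The remainder of the \<open>N\<close>-fold iteration is an antidiagonal sum of a double series dominated,
  up to a constant factor, by the case \<open>c = 0\<close> of the terms above, hence the difference of two consecutive triangular
  partial sums of a convergent series.\<close>
lemma volterra_series:
  fixes A B :: "real^'n^'n" and z h :: "real \<Rightarrow> real^'n"
  assumes comm: "A ** B = B ** A" and ab: "0 < a" "0 < b"
    and cont: "continuous_on {0..T} z" "continuous_on {0..T} h"
    and eq: "\<And>s. 0 < s \<Longrightarrow> s \<le> T \<Longrightarrow> z s = h s + A *v RL a z s + B *v RL b z s"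
    and t: "0 < t" "t \<le> T"
  shows "(\<lambda>n. \<Sum>k\<le>n. real ((k + (n - k)) choose (n - k)) *\<^sub>R
           ((matpow A k ** matpow B (n - k)) *v RL (real k * a + real (n - k) * b) h t)) sums z t"
proof -
  define X where "X f k m = (matpow A k ** matpow B m) *v RL (real k * a + real m * b) f t"
    for f :: "real \<Rightarrow> real^'n" and k m
  have sub: "continuous_on {0..t} z" "continuous_on {0..t} h"
    by (rule continuous_on_initial[OF cont(1) t(2)], rule continuous_on_initial[OF cont(2) t(2)])
  have blin: "bounded_linear ((*v) M)" for M :: "real^'n^'n"
    by (rule bounded_bilinear.bounded_linear_right[OF bounded_bilinear_matrix_vector_mult])
  have step: "X z k m = X h k m + X z (Suc k) m + X z k (Suc m)" for k m
  proof -
    define e where "e = real k * a + real m * b"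
    have e: "0 \<le> e" using ab by (simp add: e_def)
    have cA: "continuous_on {0..t} (\<lambda>s. A *v RL a z s)" "continuous_on {0..t} (\<lambda>s. B *v RL b z s)"
      using ab sub by (auto intro!: bounded_linear.continuous_on[OF blin] continuous_on_RL)
    have "RL e z t = RL e (\<lambda>s. h s + A *v RL a z s + B *v RL b z s) t"
      using t by (intro RL_cong eq) auto
    also have "\<dots> = RL e h t + RL e (\<lambda>s. A *v RL a z s) t + RL e (\<lambda>s. B *v RL b z s) t"
      using e t sub cA by (simp add: RL_add continuous_on_add)
    also have "RL e (\<lambda>s. A *v RL a z s) t = A *v RL (e + a) z t"
      using e t sub ab by (simp add: RL_bounded_linear[OF blin] continuous_on_RL RL_semigroup[of t])
    also have "RL e (\<lambda>s. B *v RL b z s) t = B *v RL (e + b) z t"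
      using e t sub ab by (simp add: RL_bounded_linear[OF blin] continuous_on_RL RL_semigroup[of t])
    finally have 1: "RL e z t = RL e h t + A *v RL (e + a) z t + B *v RL (e + b) z t" .
    have MA: "matpow A k ** matpow B m ** A = matpow A (Suc k) ** matpow B m"
      using matpow_commute[OF comm[symmetric], of m] matpow_commute[of A A k]
      by (simp add: matrix_mul_assoc[symmetric]) (simp add: matrix_mul_assoc)
    have MB: "matpow A k ** matpow B m ** B = matpow A k ** matpow B (Suc m)"
      using matpow_commute[of B B m] by (simp add: matrix_mul_assoc[symmetric])
    show ?thesis
      using arg_cong[OF 1, of "(*v) (matpow A k ** matpow B m)"] MA MB
      by (simp add: X_def e_def matrix_vector_right_distrib matrix_vector_mul_assoc algebra_simps)
  qed
  define F where "F f k m = real ((k + m) choose m) *\<^sub>R X f k m"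
    for f :: "real \<Rightarrow> real^'n" and k m
  have bin: "real (n choose k) *\<^sub>R X f k (n - k) = F f k (n - k)" if "k \<le> n" for n k f
    using that binomial_symmetric[of k n] by (simp add: F_def)
  \<comment> \<open>Unfolding every term on one antidiagonal moves to the next one along lattice paths, which
    Pascal's rule counts.\<close>
  have "X z 0 0 = (\<Sum>n<N. \<Sum>k\<le>n. real (n choose k) *\<^sub>R X h k (n - k))
      + (\<Sum>k\<le>N. real (N choose k) *\<^sub>R X z k (N - k))" for N
  proof (induction N)
    case 0
    then show ?case by simp
  next
    case (Suc N)
    have "(\<Sum>k\<le>N. real (N choose k) *\<^sub>R X z k (N - k)) =
        (\<Sum>k\<le>N. real (N choose k) *\<^sub>R X h k (N - k))
        + ((\<Sum>k\<le>N. real (N choose k) *\<^sub>R X z (Suc k) (N - k))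
        + (\<Sum>k\<le>N. real (N choose k) *\<^sub>R X z k (Suc N - k)))"
      by (subst step) (simp add: scaleR_add_right sum.distrib Suc_diff_le)
    also have "(\<Sum>k\<le>N. real (N choose k) *\<^sub>R X z k (Suc N - k))
        = X z 0 (Suc N) + (\<Sum>k\<le>N. real (N choose Suc k) *\<^sub>R X z (Suc k) (N - k))"
      using sum.atMost_Suc_shift[of "\<lambda>k. real (N choose k) *\<^sub>R X z k (Suc N - k)" N]
      by (simp add: binomial_eq_0)
    also have "(\<Sum>k\<le>N. real (N choose k) *\<^sub>R X z (Suc k) (N - k)) + \<dots>
        = X z 0 (Suc N) + (\<Sum>k\<le>N. real (Suc N choose Suc k) *\<^sub>R X z (Suc k) (N - k))"
      by (simp add: scaleR_add_left sum.distrib)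
    also have "\<dots> = (\<Sum>k\<le>Suc N. real (Suc N choose k) *\<^sub>R X z k (Suc N - k))"
      by (subst sum.atMost_Suc_shift) simp
    finally show ?case
      using Suc.IH by simp
  qed
  then have iter: "z t = (\<Sum>n<N. \<Sum>k\<le>n. F h k (n - k)) + (\<Sum>k\<le>N. F z k (N - k))" for N
    by (simp add: bin) (simp add: X_def)
  have "bounded (z ` {0..t})"
    using sub(1) by (intro compact_imp_bounded compact_continuous_image) auto
  then obtain Z where Z: "0 < Z" "\<And>s. 0 \<le> s \<Longrightarrow> s \<le> t \<Longrightarrow> norm (z s) \<le> Z"
    by (auto simp: bounded_pos)
  obtain K where K: "0 < K" "\<And>(M::real^'n^'n) v. norm (M *v v) \<le> norm M * norm v * K"
    using bounded_bilinear.pos_bounded[OF bounded_bilinear_matrix_vector_mult] by blast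
  obtain C where C: "\<And>k m. norm (mittag_leffler_term A B a b 0 t k m) \<le> C * (1/2)^k * (1/2)^m"
    using mittag_leffler_term_bound[OF ab t(1), of A B] t by (metis order_refl less_imp_le)
  have "norm (F z k m) \<le> (Z * K * C) * (1/2)^k * (1/2)^m" for k m
  proof -
    define e where "e = real k * a + real m * b"
    have e: "0 \<le> e" using ab by (simp add: e_def)
    have "norm (F z k m) \<le> real ((k + m) choose m) * (norm (matpow A k ** matpow B m) * norm (RL e z t) * K)"
      using K by (simp add: F_def X_def e_def mult_left_mono)
    also have "\<dots> \<le> real ((k + m) choose m) * (norm (matpow A k ** matpow B m) * (Z * frac_power e t) * K)"
      using K(1) e t sub Z by (intro mult_left_mono mult_right_mono RL_norm_le) auto
    also have "\<dots> = Z * K * norm (mittag_leffler_term A B a b 0 t k m)"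
      using frac_power_nonneg[OF e] by (simp add: mittag_leffler_term_def e_def)
    also have "\<dots> \<le> Z * K * (C * (1/2)^k * (1/2)^m)"
      using Z(1) K(1) by (intro mult_left_mono C) auto
    finally show ?thesis by (simp add: mult.assoc)
  qed
  from geometric_double_series_triangle[of "F z", OF this]
  have "(\<lambda>N. \<Sum>k\<le>N. F z k (N - k)) \<longlonglongrightarrow> 0"
    by (intro summable_LIMSEQ_zero sums_summable)
  then have "(\<lambda>N. z t - (\<Sum>k\<le>N. F z k (N - k))) \<longlonglongrightarrow> z t - 0"
    by (intro tendsto_intros)
  moreover have "z t - (\<Sum>k\<le>N. F z k (N - k)) = (\<Sum>n<N. \<Sum>k\<le>n. F h k (n - k))" for N
    using iter[of N] by (simp add: algebra_simps)
  ultimately show ?thesis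
    unfolding sums_def F_def X_def by simp
qed

section \<open>The solution formula\<close>

text \<open>Each term \<open>I^(ka+mb+c) g\<close> is a convolution with a kernel that is bounded because \<open>c \<ge> 1\<close>, and
  the triangular partial sums of the kernels are uniformly bounded, so a constant serves as
  the dominating function.\<close>
lemma mittag_leffler_term_convolution:
  fixes A B :: "real^'n^'n" and g :: "real \<Rightarrow> real^'n"
  assumes ab: "0 < a" "0 < b" and c: "1 \<le> c" and t: "0 < t" and g: "continuous_on {0..t} g"
  shows "(\<lambda>s. (\<Sum>k. \<Sum>m. mittag_leffler_term A B a b (c - 1) (t - s) k m) *v g s) integrable_on {0..t}" (is ?int)
    and "(\<lambda>n. \<Sum>k\<le>n. real ((k + (n - k)) choose (n - k)) *\<^sub>R
           ((matpow A k ** matpow B (n - k)) *v RL (real k * a + real (n - k) * b + c) g t)) sums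
         integral {0..t} (\<lambda>s. (\<Sum>k. \<Sum>m. mittag_leffler_term A B a b (c - 1) (t - s) k m) *v g s)" (is ?sums)
proof -
  define f where "f s k m = mittag_leffler_term A B a b (c - 1) (t - s) k m *v g s" for s k m
  define S where "S N s = (\<Sum>n<N. \<Sum>k\<le>n. mittag_leffler_term A B a b (c - 1) (t - s) k (n - k))" for N s
  have blin: "bounded_linear ((*v) M)" for M :: "real^'n^'n"
    by (rule matrix_vector_mul_bounded_linear)
  have f_int: "(f_s has_integral real ((k + m) choose m) *\<^sub>R
      ((matpow A k ** matpow B m) *v RL (real k * a + real m * b + c) g t)) {0..t}"
    if "f_s = (\<lambda>s. f s k m)" for k m f_s
  proof -
    define e where "e = real k * a + real m * b + c"
    have e: "0 < e" using ab c by (simp add: e_def add_nonneg_pos)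
    define L where "L v = (real ((k + m) choose m) / Gamma e) *\<^sub>R ((matpow A k ** matpow B m) *v v)" for v
    have L: "bounded_linear L"
      unfolding L_def by (intro bounded_linear_const_scaleR blin)
    have "((\<lambda>s. (t - s) powr (e - 1) *\<^sub>R g s) has_integral
        integral {0..t} (\<lambda>s. (t - s) powr (e - 1) *\<^sub>R g s)) {0..t}"
      using e t g by (intro integrable_integral kernel_integrable) auto
    from has_integral_linear[OF this L]
    have "((\<lambda>s. L ((t - s) powr (e - 1) *\<^sub>R g s)) has_integral
        L (integral {0..t} (\<lambda>s. (t - s) powr (e - 1) *\<^sub>R g s))) {0..t}"
      by (simp add: o_def)
    moreover have "L (integral {0..t} (\<lambda>s. (t - s) powr (e - 1) *\<^sub>R g s)) =
        real ((k + m) choose m) *\<^sub>R ((matpow A k ** matpow B m) *v RL e g t)"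
      using e by (simp add: L_def RL_def matrix_vector_mult_scaleR)
    moreover have "L ((t - s) powr (e - 1) *\<^sub>R g s) = f s k m" for s
    proof -
      have 1: "real k * a + real m * b + (c - 1) = e - 1" by (simp add: e_def)
      show ?thesis
        unfolding f_def mittag_leffler_term_def 1
        by (simp add: L_def frac_power_def matrix_vector_mult_scaleR scaleR_matrix_vector_assoc)
    qed
    ultimately show ?thesis by (simp add: that e_def)
  qed
  have S_int: "((\<lambda>s. S N s *v g s) has_integral (\<Sum>n<N. \<Sum>k\<le>n. real ((k + (n - k)) choose (n - k)) *\<^sub>R
      ((matpow A k ** matpow B (n - k)) *v RL (real k * a + real (n - k) * b + c) g t))) {0..t}" for N
  proof -
    have "S N s *v g s = (\<Sum>n<N. \<Sum>k\<le>n. f s k (n - k))" for s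
      by (simp add: S_def f_def linear_sum[OF bounded_linear.linear[OF
          bounded_bilinear.bounded_linear_left[OF bounded_bilinear_matrix_vector_mult]]])
    then show ?thesis
      by (simp only:) (intro has_integral_sum f_int finite_lessThan finite_atMost refl)
  qed
  obtain C where C: "0 \<le> C" "\<And>c t' k m. 0 \<le> c \<Longrightarrow> 0 \<le> t' \<Longrightarrow> t' \<le> t \<Longrightarrow>
    norm (mittag_leffler_term A B a b c t' k m) \<le> C * (1/2)^k * (1/2)^m"
    using mittag_leffler_term_bound[OF ab t, of A B] by metis
  have "bounded (g ` {0..t})"
    using g by (intro compact_imp_bounded compact_continuous_image) auto
  then obtain G where G: "0 < G" "\<And>s. 0 \<le> s \<Longrightarrow> s \<le> t \<Longrightarrow> norm (g s) \<le> G"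
    by (auto simp: bounded_pos)
  obtain K where K: "0 < K" "\<And>(M::real^'n^'n) v. norm (M *v v) \<le> norm M * norm v * K"
    using bounded_bilinear.pos_bounded[OF bounded_bilinear_matrix_vector_mult] by blast
  have bound: "norm (S N s *v g s) \<le> 4 * C * G * K" if "s \<in> {0..t}" for N s
  proof -
    have "norm (S N s) \<le> 4 * C"
      unfolding S_def using that c by (intro geometric_double_series_bound C(2)) auto
    then have "norm (S N s) * norm (g s) * K \<le> 4 * C * G * K"
      using that C(1) G K(1) by (intro mult_right_mono mult_mono) auto
    then show ?thesis using K(2) order_trans by blast
  qed
  have conv: "(\<lambda>N. S N s *v g s) \<longlonglongrightarrow>
      (\<Sum>k. \<Sum>m. mittag_leffler_term A B a b (c - 1) (t - s) k m) *v g s" if "s \<in> {0..t}" for s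
  proof (rule bounded_bilinear.tendsto[OF bounded_bilinear_matrix_vector_mult _ tendsto_const])
    show "(\<lambda>N. S N s) \<longlonglongrightarrow> (\<Sum>k. \<Sum>m. mittag_leffler_term A B a b (c - 1) (t - s) k m)"
      unfolding S_def sums_def[symmetric]
      using that c by (intro geometric_double_series_triangle[where C = C] C(2)) auto
  qed
  have int: "(\<lambda>s. S N s *v g s) integrable_on {0..t}" for N
    using S_int by blast
  have const: "(\<lambda>_. 4 * C * G * K) integrable_on {0..t}"
    by (intro integrable_continuous_real continuous_on_const)
  show ?int
    by (rule dominated_convergence(1)[OF int const bound conv])
  have "(\<lambda>N. integral {0..t} (\<lambda>s. S N s *v g s)) \<longlonglongrightarrow>
      integral {0..t} (\<lambda>s. (\<Sum>k. \<Sum>m. mittag_leffler_term A B a b (c - 1) (t - s) k m) *v g s)"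
    by (rule dominated_convergence(2)[OF int const bound conv])
  then show ?sums
    unfolding sums_def integral_unique[OF S_int] .
qed

theorem mainTheorem10:
  fixes A0 B0 :: "real^'n^'n"
    and \<alpha> \<beta> T :: real
    and \<eta> \<eta>' :: "real^'n"
    and g y :: "real \<Rightarrow> real^'n"
  assumes "0 < T"
    and "A0 ** B0 = B0 ** A0"
    and "1 < \<alpha>" and "\<alpha> \<le> 2" and "0 < \<beta>" and "\<beta> \<le> 1"
    and "continuous_on {0..T} g"
    and "C_k_on 2 {0..T} y"
    and "\<forall>t\<in>{0<..T}.
           caputo {0..T} \<alpha> y t - A0 *v caputo {0..T} \<beta> y t - B0 *v y t = g t"
    and "y 0 = \<eta>"
    and "deriv_on {0..T} 1 y 0 = \<eta>'"
  shows "\<forall>t\<in>{0<..T}.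
    let P = (\<lambda>k m. (real ((k + m) choose m) *
               (t powr (real k * (\<alpha> - \<beta>) + real m * \<alpha> + \<alpha>) /
                Gamma (real k * (\<alpha> - \<beta>) + real m * \<alpha> + \<alpha> + 1))) *\<^sub>R
               (matpow A0 k ** matpow B0 (m + 1)));
        Q = (\<lambda>k m. (real ((k + m) choose m) *
               (t powr (real k * (\<alpha> - \<beta>) + real m * \<alpha> + 1) /
                Gamma (real k * (\<alpha> - \<beta>) + real m * \<alpha> + 2))) *\<^sub>R
               (matpow A0 k ** matpow B0 m));
        R = (\<lambda>s k m. (real ((k + m) choose m) *
               ((t - s) powr (real k * (\<alpha> - \<beta>) + real m * \<alpha> + \<alpha> - 1) /
                Gamma (real k * (\<alpha> - \<beta>) + real m * \<alpha> + \<alpha>))) *\<^sub>R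
               (matpow A0 k ** matpow B0 m))
    in double_summable P \<and> double_summable Q \<and> (\<forall>s\<in>{0..t}. double_summable (R s)) \<and>
       (\<lambda>s. (\<Sum>k. \<Sum>m. R s k m) *v g s) integrable_on {0..t} \<and>
       y t = (mat 1 + (\<Sum>k. \<Sum>m. P k m)) *v \<eta>
           + (\<Sum>k. \<Sum>m. Q k m) *v \<eta>'
           + integral {0..t} (\<lambda>s. (\<Sum>k. \<Sum>m. R s k m) *v g s)"
proof -
  define a where "a = \<alpha> - \<beta>"
  have ab: "0 < a" "0 < \<alpha>" using assms by (auto simp: a_def)
  define z where "z = (\<lambda>s. y s - y 0)"
  define h where "h = (\<lambda>s. RL 1 (\<lambda>_. \<eta>') s + RL \<alpha> (\<lambda>s. g s + B0 *v \<eta>) s)"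
  have cont_y: "continuous_on {0..T} y"
    using C_k_on_continuous[OF assms(8), of 0] by simp
  have volterra: "z s = h s + A0 *v RL a z s + B0 *v RL \<alpha> z s" if "0 < s" "s \<le> T" for s
    using cauchy_problem_volterra[OF assms(3-6,8), where A = A0 and B = B0 and t = s] assms(9-11) that
    by (auto simp: z_def h_def a_def)
  have cont_z: "continuous_on {0..T} z"
    unfolding z_def using cont_y by (intro continuous_intros)
  have cont_h: "continuous_on {0..T} h"
    unfolding h_def using assms(3,7) by (intro continuous_intros continuous_on_RL) auto
  have bv: "bounded_linear (\<lambda>M. M *v v)" for v :: "real^'n"
    by (rule bounded_bilinear.bounded_linear_left[OF bounded_bilinear_matrix_vector_mult])
  show ?thesis
  proof
    fix t assume "t \<in> {0<..T}"
    then have t: "0 < t" "t \<le> T" by auto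
    have sub: "continuous_on {0..t} g"
      by (rule continuous_on_initial[OF assms(7) t(2)])
    obtain C where C: "0 \<le> C" "\<And>c t k m. 0 \<le> c \<Longrightarrow> 0 \<le> t \<Longrightarrow> t \<le> T \<Longrightarrow>
        norm (mittag_leffler_term A0 B0 a \<alpha> c t k m) \<le> C * (1/2)^k * (1/2)^m"
      using mittag_leffler_term_bound[OF ab assms(1), of A0 B0] by metis
    define P where "P = (\<lambda>k m. (real ((k + m) choose m) *
               (t powr (real k * (\<alpha> - \<beta>) + real m * \<alpha> + \<alpha>) /
                Gamma (real k * (\<alpha> - \<beta>) + real m * \<alpha> + \<alpha> + 1))) *\<^sub>R
               (matpow A0 k ** matpow B0 (m + 1)))"
    define Q where "Q = (\<lambda>k m. (real ((k + m) choose m) *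
               (t powr (real k * (\<alpha> - \<beta>) + real m * \<alpha> + 1) /
                Gamma (real k * (\<alpha> - \<beta>) + real m * \<alpha> + 2))) *\<^sub>R
               (matpow A0 k ** matpow B0 m))"
    define R where "R = (\<lambda>s k m. (real ((k + m) choose m) *
               ((t - s) powr (real k * (\<alpha> - \<beta>) + real m * \<alpha> + \<alpha> - 1) /
                Gamma (real k * (\<alpha> - \<beta>) + real m * \<alpha> + \<alpha>))) *\<^sub>R
               (matpow A0 k ** matpow B0 m))"
    have P: "P k m = mittag_leffler_term A0 B0 a \<alpha> \<alpha> t k m ** B0" for k m
      using matpow_commute[of B0 B0 m]
      by (simp add: P_def mittag_leffler_term_def frac_power_def a_def scalar_matrix_assoc[symmetric] matrix_mul_assoc[symmetric])
    have Q: "Q k m = mittag_leffler_term A0 B0 a \<alpha> 1 t k m" for k m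
      by (simp add: Q_def mittag_leffler_term_def frac_power_def a_def add.assoc)
    have R: "R s k m = mittag_leffler_term A0 B0 a \<alpha> (\<alpha> - 1) (t - s) k m" for s k m
      by (simp add: R_def mittag_leffler_term_def frac_power_def a_def add_diff_eq)
    obtain K where K: "0 < K" "\<And>(X :: real^'n^'n) (Y :: real^'n^'n). norm (X ** Y) \<le> norm X * norm Y * K"
      using bounded_bilinear.pos_bounded[OF bounded_bilinear_matrix_matrix_mult] by blast
    have P_le: "norm (P k m) \<le> (C * norm B0 * K) * (1/2)^k * (1/2)^m" for k m
    proof -
      have "norm (P k m) \<le> norm (mittag_leffler_term A0 B0 a \<alpha> \<alpha> t k m) * norm B0 * K"
        unfolding P by (rule K(2))
      also have "\<dots> \<le> (C * (1/2)^k * (1/2)^m) * norm B0 * K"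
        using t ab K(1) by (intro mult_right_mono C) auto
      finally show ?thesis by (simp add: algebra_simps)
    qed
    have Q_le: "norm (Q k m) \<le> C * (1/2)^k * (1/2)^m" for k m
      unfolding Q using t by (intro C) auto
    have R_le: "norm (R s k m) \<le> C * (1/2)^k * (1/2)^m" if "s \<in> {0..t}" for s k m
      unfolding R using that t assms(3) by (intro C) auto
    note R_conv = mittag_leffler_term_convolution[OF ab _ t(1) sub, of \<alpha> A0 B0, folded R]
    have R_int: "(\<lambda>s. (\<Sum>k. \<Sum>m. R s k m) *v g s) integrable_on {0..t}"
      using assms(3) by (intro R_conv) auto
    \<comment> \<open>The constants in \<open>h\<close> integrate to the \<open>Q\<close> and \<open>P\<close> terms; only the part coming from \<open>g\<close> stays
      an integral.\<close>
    have RL_h: "real ((k + m) choose m) *\<^sub>R ((matpow A0 k ** matpow B0 m) *v RL (real k * a + real m * \<alpha>) h t)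
        = Q k m *v \<eta>' + P k m *v \<eta> + real ((k + m) choose m) *\<^sub>R
            ((matpow A0 k ** matpow B0 m) *v RL (real k * a + real m * \<alpha> + \<alpha>) g t)" for k m
    proof -
      define e where "e = real k * a + real m * \<alpha>"
      have e: "0 \<le> e" using ab by (simp add: e_def)
      have c: "continuous_on {0..t} (\<lambda>s. g s + B0 *v \<eta>)" "continuous_on {0..t} (\<lambda>_. \<eta>')"
        "continuous_on {0..t} (\<lambda>_. B0 *v \<eta>)"
        using sub by (auto intro!: continuous_intros)
      have "RL e h t = RL (e + 1) (\<lambda>_. \<eta>') t + RL (e + \<alpha>) (\<lambda>s. g s + B0 *v \<eta>) t"
        unfolding h_def using e t ab c
        by (simp add: RL_add continuous_on_RL RL_semigroup[of t])
      also have "\<dots> = frac_power (e + 1) t *\<^sub>R \<eta>' + (RL (e + \<alpha>) g t + frac_power (e + \<alpha>) t *\<^sub>R (B0 *v \<eta>))"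
        using e t ab c sub by (simp add: RL_add RL_const)
      finally show ?thesis
        by (simp add: P Q mittag_leffler_term_def e_def[symmetric] matrix_vector_right_distrib scaleR_add_right
            matrix_vector_mult_scaleR scaleR_matrix_vector_assoc[symmetric] matrix_vector_mul_assoc
            scalar_matrix_assoc[symmetric])
    qed
    have "(\<lambda>n. \<Sum>k\<le>n. Q k (n - k) *v \<eta>' + P k (n - k) *v \<eta> + real ((k + (n - k)) choose (n - k)) *\<^sub>R
            ((matpow A0 k ** matpow B0 (n - k)) *v RL (real k * a + real (n - k) * \<alpha> + \<alpha>) g t)) sums z t"
      using volterra_series[OF assms(2) ab cont_z cont_h volterra t] by (simp only: RL_h)
    moreover have "(\<lambda>n. \<Sum>k\<le>n. Q k (n - k) *v \<eta>' + P k (n - k) *v \<eta> + real ((k + (n - k)) choose (n - k)) *\<^sub>R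
            ((matpow A0 k ** matpow B0 (n - k)) *v RL (real k * a + real (n - k) * \<alpha> + \<alpha>) g t)) sums
          ((\<Sum>k. \<Sum>m. Q k m) *v \<eta>' + (\<Sum>k. \<Sum>m. P k m) *v \<eta>
            + integral {0..t} (\<lambda>s. (\<Sum>k. \<Sum>m. R s k m) *v g s))"
    proof -
      have "(\<lambda>n. (\<Sum>k\<le>n. Q k (n - k)) *v \<eta>' + (\<Sum>k\<le>n. P k (n - k)) *v \<eta> +
          (\<Sum>k\<le>n. real ((k + (n - k)) choose (n - k)) *\<^sub>R
            ((matpow A0 k ** matpow B0 (n - k)) *v RL (real k * a + real (n - k) * \<alpha> + \<alpha>) g t))) sums
          ((\<Sum>k. \<Sum>m. Q k m) *v \<eta>' + (\<Sum>k. \<Sum>m. P k m) *v \<eta>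
            + integral {0..t} (\<lambda>s. (\<Sum>k. \<Sum>m. R s k m) *v g s))"
        using assms(3)
        by (intro sums_add bounded_linear.sums[OF bv] R_conv(2)
            geometric_double_series_triangle[OF Q_le] geometric_double_series_triangle[OF P_le]) auto
      then show ?thesis
        by (simp only: linear_sum[OF bounded_linear.linear[OF bv]] sum.distrib)
    qed
    ultimately have "z t = (\<Sum>k. \<Sum>m. Q k m) *v \<eta>' + (\<Sum>k. \<Sum>m. P k m) *v \<eta>
            + integral {0..t} (\<lambda>s. (\<Sum>k. \<Sum>m. R s k m) *v g s)"
      by (rule sums_unique2)
    then have "y t = (mat 1 + (\<Sum>k. \<Sum>m. P k m)) *v \<eta> + (\<Sum>k. \<Sum>m. Q k m) *v \<eta>'
            + integral {0..t} (\<lambda>s. (\<Sum>k. \<Sum>m. R s k m) *v g s)"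
      using assms(10) by (simp add: z_def matrix_vector_mult_add_rdistrib algebra_simps)
    moreover have "double_summable P" "double_summable Q" "\<forall>s\<in>{0..t}. double_summable (R s)"
      using geometric_double_series_summable P_le Q_le R_le by blast+
    ultimately show "let P = (\<lambda>k m. (real ((k + m) choose m) *
               (t powr (real k * (\<alpha> - \<beta>) + real m * \<alpha> + \<alpha>) /
                Gamma (real k * (\<alpha> - \<beta>) + real m * \<alpha> + \<alpha> + 1))) *\<^sub>R
               (matpow A0 k ** matpow B0 (m + 1)));
        Q = (\<lambda>k m. (real ((k + m) choose m) *
               (t powr (real k * (\<alpha> - \<beta>) + real m * \<alpha> + 1) /
                Gamma (real k * (\<alpha> - \<beta>) + real m * \<alpha> + 2))) *\<^sub>R
               (matpow A0 k ** matpow B0 m));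
        R = (\<lambda>s k m. (real ((k + m) choose m) *
               ((t - s) powr (real k * (\<alpha> - \<beta>) + real m * \<alpha> + \<alpha> - 1) /
                Gamma (real k * (\<alpha> - \<beta>) + real m * \<alpha> + \<alpha>))) *\<^sub>R
               (matpow A0 k ** matpow B0 m))
      in double_summable P \<and> double_summable Q \<and> (\<forall>s\<in>{0..t}. double_summable (R s)) \<and>
       (\<lambda>s. (\<Sum>k. \<Sum>m. R s k m) *v g s) integrable_on {0..t} \<and>
       y t = (mat 1 + (\<Sum>k. \<Sum>m. P k m)) *v \<eta>
           + (\<Sum>k. \<Sum>m. Q k m) *v \<eta>'
           + integral {0..t} (\<lambda>s. (\<Sum>k. \<Sum>m. R s k m) *v g s)"
      using R_int unfolding P_def[symmetric] Q_def[symmetric] R_def[symmetric] Let_def by blast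
  qed
qed

end
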